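(* There exists a partial function $f\colon\subseteq\omega\to\omega$ such that $K(f)\equiv_{\rm subT} f$.
   Context: For a partial computable function $\Phi$ from finite sequences of natural numbers to $\{0,1\}\times\omega$ and a partial function $g\colon\subseteq\omega\to\omega$, the $g$-relative sequential computation $\Phi[g]$ is defined as follows. On input $n$, with oracle answers $a_0,\dots,a_{s-1}$ obtained so far: if $\Phi(n,a_0,\dots,a_{s-1})$ is undefined, $\Phi[g](n)$ is undefined; if it equals $\langle 1,q\rangle$ the computation halts with output $q$; if it equals $\langle 0,q\rangle$, $q$ is a query, and if $q\in{\rm dom}(g)$ the computation continues with $a_s=g(q)$, while if $q\notin{\rm dom}(g)$ the computation never halts. $\Phi_e$ is the $e$-th such partial computable function. $f\leq_{\rm subT} g$ means $f\subseteq\Phi_e[g]$ for some $e$; $\equiv_{\rm subT}$ is mutual reducibility. The relative halting problem $K(f)$ is the partial function: $K(f)(e)=1$ if $\Phi_e[f](e)$ halts; $K(f)(e)=0$ if $\Phi_e[f](e)$ does not halt and never makes a query outside ${\rm dom}(f)$; $K(f)(e)$ is undefined if $\Phi_e[f](e)$ fails to halt because it makes a query outside ${\rm dom}(f)$. *)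

theory Defs
  imports "HOL-Library.Nat_Bijection"
begin

section \<open>Partial recursive functions and a Goedel numbering\<close>

datatype recf =
    Zero
  | Succ
  | Proj nat
  | Comp recf "recf list"
  | PrimRec recf recf
  | Mu recf

text \<open>
  A program is run on argument lists of arbitrary length and is undefined (\<open>None\<close>) on lists whose
  length does not fit. In primitive recursion and minimisation the distinguished argument is the
  first one.
\<close>

fun eval :: "recf \<Rightarrow> nat list \<Rightarrow> nat option" where
  "eval Zero xs = Some 0"
| "eval Succ xs = (case xs of [x] \<Rightarrow> Some (Suc x) | _ \<Rightarrow> None)"
| "eval (Proj i) xs = (if i < length xs then Some (xs ! i) else None)"
| "eval (Comp p ps) xs =
    (if \<forall>r\<in>set ps. eval r xs \<noteq> None
     then eval p (map (\<lambda>r. the (eval r xs)) ps) else None)"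
| "eval (PrimRec p r) xs =
    (case xs of
       [] \<Rightarrow> None
     | n # ys \<Rightarrow>
         rec_nat (eval p ys) (\<lambda>m v. Option.bind v (\<lambda>y. eval r (m # y # ys))) n)"
| "eval (Mu p) xs =
    (if \<exists>n. eval p (n # xs) = Some 0 \<and> (\<forall>m<n. eval p (m # xs) \<noteq> None)
     then Some (LEAST n. eval p (n # xs) = Some 0) else None)"

lemma list_decode_member_le: "x \<in> set (list_decode n) \<Longrightarrow> x \<le> n"
proof (induction n arbitrary: x rule: less_induct)
  case (less n)
  show ?case
  proof (cases n)
    case 0
    with less.prems show ?thesis by simp
  next
    case (Suc m)
    obtain a b where ab: "prod_decode m = (a, b)" by (cases "prod_decode m")
    then have m: "m = prod_encode (a, b)" by (metis prod_decode_inverse)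
    have "a \<le> m" "b \<le> m" unfolding m by (rule le_prod_encode_1, rule le_prod_encode_2)
    moreover have "x = a \<or> x \<in> set (list_decode b)" using less.prems Suc ab by simp
    ultimately show ?thesis using less.IH[of b x] Suc by auto
  qed
qed

lemma fst_prod_decode_le: "fst (prod_decode n) \<le> n"
  by (metis le_prod_encode_1 prod.collapse prod_decode_inverse)

lemma snd_prod_decode_le: "snd (prod_decode n) \<le> n"
  by (metis le_prod_encode_2 prod.collapse prod_decode_inverse)

lemma fst_prod_decode_div4_less: "fst (prod_decode (n div 4)) < Suc (Suc n)"
  using fst_prod_decode_le[of "n div 4"] by linarith

lemma snd_prod_decode_div4_less: "snd (prod_decode (n div 4)) < Suc (Suc n)"
  using snd_prod_decode_le[of "n div 4"] by linarith

lemma list_decode_snd_prod_decode_div4_less: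
  "x \<in> set (list_decode (snd (prod_decode (n div 4)))) \<Longrightarrow> x < Suc (Suc n)"
  using list_decode_member_le[of x] snd_prod_decode_div4_less[of n] by (meson le_less_trans)

function (sequential) decode_recf :: "nat \<Rightarrow> recf" where
  "decode_recf 0 = Zero"
| "decode_recf (Suc 0) = Succ"
| "decode_recf (Suc (Suc n)) =
    (if n mod 4 = 0 then Proj (n div 4)
     else if n mod 4 = 1 then
       Comp (decode_recf (fst (prod_decode (n div 4))))
            (map decode_recf (list_decode (snd (prod_decode (n div 4)))))
     else if n mod 4 = 2 then
       PrimRec (decode_recf (fst (prod_decode (n div 4))))
               (decode_recf (snd (prod_decode (n div 4))))
     else Mu (decode_recf (n div 4)))"
  by pat_completeness auto
termination
  by (relation "measure id")
     (auto simp: fst_prod_decode_div4_less snd_prod_decode_div4_less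
        list_decode_snd_prod_decode_div4_less simp del: One_nat_def)

lemma decode_recf_Comp:
  "decode_recf (Suc (Suc (4 * k + 1))) =
    Comp (decode_recf (fst (prod_decode k))) (map decode_recf (list_decode (snd (prod_decode k))))"
proof -
  have "(4 * k + 1) div 4 = k" "(4 * k + 1) mod 4 = 1" by presburger+
  then show ?thesis by (simp only: decode_recf.simps(3)) simp
qed

lemma decode_recf_PrimRec:
  "decode_recf (Suc (Suc (4 * k + 2))) =
    PrimRec (decode_recf (fst (prod_decode k))) (decode_recf (snd (prod_decode k)))"
proof -
  have "(4 * k + 2) div 4 = k" "(4 * k + 2) mod 4 = 2" by presburger+
  then show ?thesis by (simp only: decode_recf.simps(3)) simp
qed

lemma decode_recf_Mu: "decode_recf (Suc (Suc (4 * k + 3))) = Mu (decode_recf k)"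
proof -
  have "(4 * k + 3) div 4 = k" "(4 * k + 3) mod 4 = 3" by presburger+
  then show ?thesis by (simp only: decode_recf.simps(3)) simp
qed

lemma surj_decode_recf: "\<exists>e. decode_recf e = p"
proof (induction p)
  case Zero
  show ?case by (rule exI[of _ 0]) simp
next
  case Succ
  show ?case by (rule exI[of _ "Suc 0"]) simp
next
  case (Proj i)
  show ?case by (rule exI[of _ "Suc (Suc (4 * i))"]) simp
next
  case (Comp p ps)
  from Comp(1) obtain a where a: "decode_recf a = p" by blast
  from Comp(2) have "\<forall>r\<in>set ps. \<exists>e. decode_recf e = r" by blast
  then obtain c where c: "\<forall>r\<in>set ps. decode_recf (c r) = r" by metis
  then have "map decode_recf (map c ps) = ps" by (simp add: map_idI)
  then have "Comp p ps =
      decode_recf (Suc (Suc (4 * prod_encode (a, list_encode (map c ps)) + 1)))"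
    unfolding decode_recf_Comp by (simp add: a)
  then show ?case by metis
next
  case (PrimRec p r)
  then obtain a b where ab: "decode_recf a = p" "decode_recf b = r" by blast
  have "PrimRec p r = decode_recf (Suc (Suc (4 * prod_encode (a, b) + 2)))"
    unfolding decode_recf_PrimRec by (simp add: ab)
  then show ?case by metis
next
  case (Mu p)
  then show ?case using decode_recf_Mu by metis
qed

text \<open>
  \<open>Phi e\<close> is the \<open>e\<close>-th partial computable function from finite sequences of natural numbers to
  \<open>{0,1} \<times> \<omega>\<close>. Sequences are coded by \<^const>\<open>list_encode\<close>; a value \<open>v\<close> codes the pair
  \<open>\<langle>v mod 2, v div 2\<rangle>\<close>, the bits 0 and 1 being \<^const>\<open>False\<close> and \<^const>\<open>True\<close>.
\<close>

definition Phi :: "nat \<Rightarrow> nat list \<Rightarrow> (bool \<times> nat) option" where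
  "Phi e \<sigma> = map_option (\<lambda>v. (odd v, v div 2)) (eval (decode_recf e) [list_encode \<sigma>])"


section \<open>Relative sequential computation\<close>

text \<open>\<open>answers F g n \<sigma>\<close>: on input \<open>n\<close>, the computation reaches a stage at which the oracle
  answers obtained so far are exactly \<open>\<sigma>\<close>.\<close>

inductive answers ::
  "(nat list \<Rightarrow> (bool \<times> nat) option) \<Rightarrow> (nat \<rightharpoonup> nat) \<Rightarrow> nat \<Rightarrow> nat list \<Rightarrow> bool"
  for F g n where
  start: "answers F g n []"
| query: "answers F g n \<sigma> \<Longrightarrow> F (n # \<sigma>) = Some (False, q) \<Longrightarrow> g q = Some a
    \<Longrightarrow> answers F g n (\<sigma> @ [a])"

definition halts_with ::
  "(nat list \<Rightarrow> (bool \<times> nat) option) \<Rightarrow> (nat \<rightharpoonup> nat) \<Rightarrow> nat \<Rightarrow> nat \<Rightarrow> bool" where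
  "halts_with F g n q \<longleftrightarrow> (\<exists>\<sigma>. answers F g n \<sigma> \<and> F (n # \<sigma>) = Some (True, q))"

definition queries_outside ::
  "(nat list \<Rightarrow> (bool \<times> nat) option) \<Rightarrow> (nat \<rightharpoonup> nat) \<Rightarrow> nat \<Rightarrow> bool" where
  "queries_outside F g n \<longleftrightarrow>
    (\<exists>\<sigma> q. answers F g n \<sigma> \<and> F (n # \<sigma>) = Some (False, q) \<and> q \<notin> dom g)"

definition seq_comp ::
  "(nat list \<Rightarrow> (bool \<times> nat) option) \<Rightarrow> (nat \<rightharpoonup> nat) \<Rightarrow> (nat \<rightharpoonup> nat)" where
  "seq_comp F g n = (if \<exists>q. halts_with F g n q then Some (THE q. halts_with F g n q) else None)"

lemma answers_prefix:
  "answers F g n \<sigma> \<Longrightarrow> answers F g n \<tau> \<Longrightarrow> length \<sigma> \<le> length \<tau> \<Longrightarrow> take (length \<sigma>) \<tau> = \<sigma>"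
proof (induction \<sigma> arbitrary: \<tau> rule: answers.induct)
  case start
  show ?case by simp
next
  case (query \<sigma> q a)
  from query.prems show ?case
  proof (induction \<tau> rule: answers.induct)
    case start
    then show ?case by simp
  next
    case IH2: (query \<tau> q' a')
    show ?case
    proof (cases "length \<sigma> < length \<tau>")
      case True
      then show ?thesis using IH2 by simp
    next
      case False
      then have "length \<sigma> = length \<tau>" using IH2.prems by simp
      moreover from this have "\<tau> = \<sigma>" using query.IH[OF IH2.hyps(1)] by simp
      ultimately show ?thesis using query.hyps IH2.hyps by simp
    qed
  qed
qed

lemma answers_halted_longest:
  assumes "answers F g n \<sigma>" "F (n # \<sigma>) = Some (True, q)" "answers F g n \<tau>"
  shows "length \<tau> \<le> length \<sigma>"
  using assms(3)
proof (induction \<tau> rule: answers.induct)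
  case start
  show ?case by simp
next
  case (query \<tau> q' a)
  have "\<tau> \<noteq> \<sigma>" using query.hyps assms(2) by auto
  moreover have "length \<tau> = length \<sigma> \<Longrightarrow> \<tau> = \<sigma>"
    using answers_prefix[OF query.hyps(1) assms(1)] by simp
  ultimately show ?case using query.IH by fastforce
qed

lemma halts_with_unique:
  assumes "halts_with F g n q" "halts_with F g n q'"
  shows "q = q'"
proof -
  from assms obtain \<sigma> \<tau> where st:
    "answers F g n \<sigma>" "F (n # \<sigma>) = Some (True, q)"
    "answers F g n \<tau>" "F (n # \<tau>) = Some (True, q')"
    unfolding halts_with_def by blast
  then have "length \<sigma> = length \<tau>" using answers_halted_longest by (meson le_antisym)
  then have "\<sigma> = \<tau>" using answers_prefix[OF st(1,3)] by simp
  with st show ?thesis by simp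
qed

lemma seq_comp_eq_Some_iff: "seq_comp F g n = Some q \<longleftrightarrow> halts_with F g n q"
proof -
  have "(THE r. halts_with F g n r) = q" if "halts_with F g n q" for q
    using that halts_with_unique by (metis the_equality)
  then show ?thesis unfolding seq_comp_def by auto
qed


section \<open>Reducibility and the relative halting problem\<close>

definition subT_le :: "(nat \<rightharpoonup> nat) \<Rightarrow> (nat \<rightharpoonup> nat) \<Rightarrow> bool" (infix \<open>\<le>\<^sub>s\<^sub>u\<^sub>b\<^sub>T\<close> 50) where
  "f \<le>\<^sub>s\<^sub>u\<^sub>b\<^sub>T g \<longleftrightarrow> (\<exists>e. f \<subseteq>\<^sub>m seq_comp (Phi e) g)"

definition subT_equiv :: "(nat \<rightharpoonup> nat) \<Rightarrow> (nat \<rightharpoonup> nat) \<Rightarrow> bool" (infix \<open>\<equiv>\<^sub>s\<^sub>u\<^sub>b\<^sub>T\<close> 50) where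
  "f \<equiv>\<^sub>s\<^sub>u\<^sub>b\<^sub>T g \<longleftrightarrow> f \<le>\<^sub>s\<^sub>u\<^sub>b\<^sub>T g \<and> g \<le>\<^sub>s\<^sub>u\<^sub>b\<^sub>T f"

definition rel_halting :: "(nat \<rightharpoonup> nat) \<Rightarrow> (nat \<rightharpoonup> nat)" where
  "rel_halting f e =
    (if seq_comp (Phi e) f e \<noteq> None then Some 1
     else if \<not> queries_outside (Phi e) f e then Some 0
     else None)"

end

theory Submission
  imports Defs
begin

text \<open>
  The operator \<open>K\<close> is monotone for inclusion of partial functions: enlarging the oracle does not
  change a computation that never queries outside the domain of the smaller one. Partial functions
  form a chain-complete partial order, so \<open>K\<close> has a fixed point \<open>f = K(f)\<close>, and the theorem reduces
  to reflexivity of the reducibility.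
\<close>

section \<open>Reflexivity\<close>

definition add_prog :: recf where
  "add_prog = PrimRec (Proj 0) (Comp Succ [Proj 1])"

lemma eval_add_prog [simp]: "eval add_prog [x, y] = Some (x + y)"
  by (induction x) (simp_all add: add_prog_def)

definition pred_prog :: recf where
  "pred_prog = PrimRec Zero (Proj 0)"

lemma eval_pred_prog [simp]: "eval pred_prog [x] = Some (x - 1)"
  by (cases x) (simp_all add: pred_prog_def, induct_tac nat, simp_all)

text \<open>The subtrahend comes first because primitive recursion runs on the first
  argument.\<close>

definition rsub_prog :: recf where
  "rsub_prog = PrimRec (Proj 0) (Comp pred_prog [Proj 1])"

lemma eval_rsub_prog [simp]: "eval rsub_prog [x, y] = Some (y - x)"
  by (induction x) (simp_all add: rsub_prog_def)

definition triangle_prog :: recf where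
  "triangle_prog = PrimRec Zero (Comp Succ [Comp add_prog [Proj 0, Proj 1]])"

lemma eval_triangle_prog [simp]: "eval triangle_prog [x] = Some (triangle x)"
  by (induction x) (simp_all add: triangle_prog_def)

text \<open>
  The code \<open>c\<close> of a list with head \<open>n\<close> and tail code \<open>b\<close> is \<open>Suc (triangle (n + b) + n)\<close>, so
  \<open>n + b\<close> is the least \<open>s\<close> with \<open>c \<le> triangle (Suc s)\<close>, and \<open>b\<close> is then \<open>triangle (Suc s) - c\<close>.
\<close>

definition diag_prog :: recf where
  "diag_prog = Mu (Comp rsub_prog [Comp triangle_prog [Comp Succ [Proj 0]], Proj 1])"

lemma triangle_mono: "m \<le> n \<Longrightarrow> triangle m \<le> triangle n"
  unfolding triangle_def by (intro div_le_mono mult_le_mono) auto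

lemma eval_diag_prog [simp]:
  "eval diag_prog [list_encode (n # \<sigma>)] = Some (n + list_encode \<sigma>)"
proof -
  let ?s = "n + list_encode \<sigma>"
  have c: "list_encode (n # \<sigma>) = Suc (triangle ?s + n)"
    by (simp add: prod_encode_def)
  \<comment> \<open>The code exceeds \<open>triangle ?s\<close>, and since \<open>n \<le> ?s\<close>
    it is at most \<open>triangle (Suc ?s)\<close>.\<close>
  have "Suc (triangle ?s + n) \<le> triangle (Suc s) \<longleftrightarrow> ?s \<le> s" for s
    using triangle_mono[of "Suc s" ?s] triangle_mono[of "Suc ?s" "Suc s"]
    by (cases "?s \<le> s") auto
  then have least: "Suc (triangle ?s + n) - triangle (Suc s) = 0 \<longleftrightarrow> ?s \<le> s" for s
    by simp
  have "(LEAST s. ?s \<le> s) = ?s"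
    by (rule Least_equality) auto
  then show ?thesis
    unfolding diag_prog_def c by (auto simp: least simp del: triangle_Suc diff_is_0_eq)
qed

definition tl_prog :: recf where
  "tl_prog = Comp rsub_prog [Proj 0, Comp triangle_prog [Comp Succ [diag_prog]]]"

lemma eval_tl_prog [simp]: "eval tl_prog [list_encode (n # \<sigma>)] = Some (list_encode \<sigma>)"
  by (simp add: tl_prog_def del: list_encode.simps) (simp add: prod_encode_def)

definition hd_prog :: recf where
  "hd_prog = Comp rsub_prog [tl_prog, diag_prog]"

lemma eval_hd_prog [simp]: "eval hd_prog [list_encode (n # \<sigma>)] = Some n"
  by (simp add: hd_prog_def del: list_encode.simps)

text \<open>Tail code 0 means no answer yet: the even value \<open>2 * n\<close> queries
  \<open>n\<close>. A nonempty tail with head \<open>a\<close> gives the odd value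
  \<open>2 * a + 1\<close>, which halts with output \<open>a\<close>.\<close>

definition refl_prog :: recf where
  "refl_prog =
    Comp
      (PrimRec (Comp add_prog [Proj 0, Proj 0])
        (Comp Succ
          [Comp add_prog [Comp hd_prog [Comp Succ [Proj 0]], Comp hd_prog [Comp Succ [Proj 0]]]]))
      [tl_prog, hd_prog]"

lemma eval_refl_prog_query: "eval refl_prog [list_encode [n]] = Some (2 * n)"
  using eval_tl_prog[of n "[]"] eval_hd_prog[of n "[]"] by (simp add: refl_prog_def)

text \<open>Primitive recursion on the tail code serves as a case distinction, but all its stages must be
  defined; hence \<^const>\<open>hd_prog\<close> has to converge on every nonzero code.\<close>

lemma eval_hd_prog_total: "\<exists>y. eval hd_prog [Suc m] = Some y"
proof -
  obtain n \<sigma> where "list_decode (Suc m) = n # \<sigma>"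
    by (cases "prod_decode m") simp
  then have "Suc m = list_encode (n # \<sigma>)"
    by (metis list_decode_inverse)
  then show ?thesis
    by (metis eval_hd_prog)
qed

lemma eval_refl_prog_answer: "eval refl_prog [list_encode [n, a]] = Some (Suc (2 * a))"
proof -
  define r where "r =
    Comp Succ [Comp add_prog [Comp hd_prog [Comp Succ [Proj 0]], Comp hd_prog [Comp Succ [Proj 0]]]]"
  \<comment> \<open>The step ignores the recursive value. At counter \<open>m\<close> the tail code
    is \<open>Suc m\<close>, hence the successor under \<open>hd_prog\<close>.\<close>
  have r: "eval r (m # xs) = Some (Suc (2 * the (eval hd_prog [Suc m])))" for m xs
    using eval_hd_prog_total[of m] by (auto simp: r_def)
  have total: "\<exists>y. eval (PrimRec (Comp add_prog [Proj 0, Proj 0]) r) [m, n] = Some y" for m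
    by (induction m) (auto simp: r)
  have pr: "eval (PrimRec (Comp add_prog [Proj 0, Proj 0]) r) [Suc m, n] =
      Some (Suc (2 * the (eval hd_prog [Suc m])))" for m
    using total[of m] by (auto simp: r)
  have "eval refl_prog [list_encode [n, a]] =
      eval (PrimRec (Comp add_prog [Proj 0, Proj 0]) r) [list_encode [a], n]"
    by (simp add: refl_prog_def r_def del: list_encode.simps eval.simps(5))
  also have "\<dots> = Some (Suc (2 * the (eval hd_prog [list_encode [a]])))"
    using pr by (simp del: eval.simps eval_hd_prog)
  finally show ?thesis
    by (simp del: list_encode.simps)
qed

lemma subT_le_refl: "f \<le>\<^sub>s\<^sub>u\<^sub>b\<^sub>T f"
proof -
  obtain e where e: "decode_recf e = refl_prog"
    using surj_decode_recf by blast
  have query: "Phi e [n] = Some (False, n)" for n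
    using eval_refl_prog_query[of n] by (simp add: Phi_def e del: list_encode.simps)
  have answer: "Phi e [n, a] = Some (True, a)" for n a
    using eval_refl_prog_answer[of n a] by (simp add: Phi_def e del: list_encode.simps)
  have "seq_comp (Phi e) f n = Some a" if "f n = Some a" for n a
  proof -
    have "answers (Phi e) f n [a]"
      using answers.query[of "Phi e" f n "[]", OF answers.start query that] by simp
    then show ?thesis
      using answer seq_comp_eq_Some_iff halts_with_def by metis
  qed
  then show ?thesis
    unfolding subT_le_def map_le_def by (metis domIff not_None_eq)
qed

section \<open>Monotonicity of the relative halting problem\<close>

lemma answers_mono:
  assumes "answers F f n \<sigma>" "f \<subseteq>\<^sub>m g"
  shows "answers F g n \<sigma>"
  using assms(1)
proof induction
  case (query \<sigma> q a)
  then have "g q = Some a"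
    using assms(2) by (metis domI map_le_def)
  then show ?case
    using query answers.query by metis
qed (rule answers.start)

text \<open>By induction along the run: each query comes at a stage already reached over
  \<open>f\<close>, so it lies in \<open>dom f\<close>, where \<open>g\<close> gives the same
  answer.\<close>

lemma answers_antimono:
  assumes "answers F g n \<sigma>" "f \<subseteq>\<^sub>m g" "\<not> queries_outside F f n"
  shows "answers F f n \<sigma>"
  using assms(1)
proof induction
  case (query \<sigma> q a)
  then have "q \<in> dom f"
    using assms(3) unfolding queries_outside_def by blast
  then have "f q = Some a"
    using assms(2) query.hyps by (simp add: map_le_def)
  then show ?case
    using query answers.query by metis
qed (rule answers.start)

lemma rel_halting_mono:
  assumes "f \<subseteq>\<^sub>m g"
  shows "rel_halting f \<subseteq>\<^sub>m rel_halting g"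
proof -
  have "rel_halting g e = rel_halting f e" if "rel_halting f e \<noteq> None" for e
  proof (cases "seq_comp (Phi e) f e = None")
    case False
    then obtain q where "halts_with (Phi e) f e q"
      using seq_comp_eq_Some_iff by blast
    then have "halts_with (Phi e) g e q"
      using answers_mono[OF _ assms] unfolding halts_with_def by blast
    then have "seq_comp (Phi e) g e \<noteq> None"
      using seq_comp_eq_Some_iff by fastforce
    with False show ?thesis
      by (simp add: rel_halting_def)
  next
    case True
    with that have inside: "\<not> queries_outside (Phi e) f e"
      by (auto simp: rel_halting_def)
    \<comment> \<open>This is the value 0 case: stages reached over \<open>g\<close> are stages over
      \<open>f\<close>, so \<open>g\<close> brings neither a halt nor an outside query.\<close>
    note restrict = answers_antimono[OF _ assms inside]
    have "seq_comp (Phi e) g e = None"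
      using True restrict seq_comp_eq_Some_iff unfolding halts_with_def by (metis option.exhaust)
    moreover have "dom f \<subseteq> dom g"
      using assms by (rule map_le_implies_dom_le)
    then have "\<not> queries_outside (Phi e) g e"
      using inside restrict unfolding queries_outside_def by blast
    ultimately show ?thesis
      using True inside by (simp add: rel_halting_def)
  qed
  then show ?thesis
    by (auto simp: map_le_def)
qed

text \<open>With \<open>None\<close> as bottom of a flat order, inclusion is the pointwise order,
  which is chain-complete; monotone operators on it have fixed points.\<close>

lemma map_le_mono_fixpoint:
  fixes H :: "('a \<rightharpoonup> 'b) \<Rightarrow> ('a \<rightharpoonup> 'b)"
  assumes "\<And>f g. f \<subseteq>\<^sub>m g \<Longrightarrow> H f \<subseteq>\<^sub>m H g"
  shows "\<exists>f. H f = f"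
proof -
  have ord: "fun_ord (flat_ord None) f g \<longleftrightarrow> f \<subseteq>\<^sub>m g" for f g :: "'a \<rightharpoonup> 'b"
    unfolding fun_ord_def flat_ord_def map_le_def by (metis domIff)
  have cpo: "class.ccpo (fun_lub (flat_lub None)) (fun_ord (flat_ord None))
      (mk_less (fun_ord (flat_ord None :: 'b option \<Rightarrow> _)) :: ('a \<rightharpoonup> 'b) \<Rightarrow> _)"
    by (rule ccpo[OF partial_function_lift[OF flat_interpretation]])
  have "monotone (fun_ord (flat_ord None)) (fun_ord (flat_ord None)) H"
    by (rule monotoneI) (simp add: ord assms)
  from ccpo.fixp_unfold[OF cpo this] show ?thesis
    by metis
qed

theorem theorem3p7: "\<exists>f :: nat \<rightharpoonup> nat. rel_halting f \<equiv>\<^sub>s\<^sub>u\<^sub>b\<^sub>T f"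
proof -
  obtain f where "rel_halting f = f"
    using map_le_mono_fixpoint[of rel_halting] rel_halting_mono by blast
  then show ?thesis
    by (metis subT_equiv_def subT_le_refl)
qed

end
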